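(* For matrices $A\in\mathbb R^{r\times n}$, $B\in\mathbb R^{r\times m}$, $D\in\mathbb R^{q\times m}$ and a vector $d\in\mathbb R^r$, let $f\colon\mathbb R^n\times\mathbb R^m\to\mathbb R^q$ and $\Gamma\colon\mathbb R^n\rightrightarrows\mathbb R^m$ be given by $f(x,y):=Dy$ and $\Gamma(x):=\{y\in\mathbb R^m\mid Ax+By\leq d\}$ for all $x\in\mathbb R^n$, $y\in\mathbb R^m$, and let the ordering cone be $\mathcal C:=\mathbb R^q_+$. Then the associated mappings $\Psi\colon\mathbb R^n\rightrightarrows\mathbb R^m$ and $\Phi\colon\mathbb R^n\rightrightarrows\mathbb R^q$ possess closed graphs.
   Context: For $x\in\mathbb R^n$, with $f(x,A'):=\{f(x,y)\mid y\in A'\}$ for $A'\subset\mathbb R^m$, the efficiency mapping is $\Psi(x):=\{y\in\Gamma(x)\mid (\{f(x,y)\}-\mathcal C\setminus\{0\})\cap f(x,\Gamma(x))=\emptyset\}$ and the frontier mapping is $\Phi(x):=f(x,\Psi(x))$ (values may be empty). The graph of a set-valued mapping $\Upsilon$ is $\operatorname{gph}\Upsilon:=\{(x,y)\mid y\in\Upsilon(x)\}$. Vector inequalities are componentwise. *)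

theory Defs
  imports "HOL-Analysis.Analysis"
begin

text \<open>A set-valued mapping is a function into sets; its values may be empty.\<close>

definition gph :: "('a \<Rightarrow> 'b set) \<Rightarrow> ('a \<times> 'b) set" where
  "gph \<Upsilon> = {(x, y). y \<in> \<Upsilon> x}"

text \<open>The image \<open>(\<lambda>c. f x y - c) ` (C - {0})\<close> is the Minkowski difference of
  \<open>{f x y}\<close> and \<open>C - {0}\<close>; between sets, \<open>-\<close> denotes set difference.\<close>

definition efficiency_mapping ::
  "('a \<Rightarrow> 'b \<Rightarrow> 'c::ab_group_add) \<Rightarrow> ('a \<Rightarrow> 'b set) \<Rightarrow> 'c set \<Rightarrow> 'a \<Rightarrow> 'b set" where
  "efficiency_mapping f \<Gamma> C x =
     {y \<in> \<Gamma> x. (\<lambda>c. f x y - c) ` (C - {0}) \<inter> f x ` \<Gamma> x = {}}"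

definition frontier_mapping ::
  "('a \<Rightarrow> 'b \<Rightarrow> 'c::ab_group_add) \<Rightarrow> ('a \<Rightarrow> 'b set) \<Rightarrow> 'c set \<Rightarrow> 'a \<Rightarrow> 'c set" where
  "frontier_mapping f \<Gamma> C x = f x ` efficiency_mapping f \<Gamma> C x"

end

theory Submission
  imports Defs
begin

text \<open>For a feasible point, efficiency depends only on the set of active constraints: it says that
  no direction \<open>v\<close> satisfies \<open>(B v)\<^sub>i \<le> 0\<close> for all active \<open>i\<close>, \<open>D v \<le> 0\<close> and \<open>D v \<noteq> 0\<close>. This condition
  is monotone in the active set, so the graph of the efficiency mapping is a finite union of faces
  of the polyhedron \<open>{(x, y). A x + B y \<le> d}\<close>. The graph of the frontier mapping is the union of the
  images of these faces under \<open>(x, y) \<mapsto> (x, D y)\<close>. Such an image is the preimage of a finitely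
  generated cone under \<open>(x, z) \<mapsto> (d - A x, z)\<close>, hence closed.\<close>

lemma convex_cone_hull_sum:
  assumes "\<And>i. i \<in> I \<Longrightarrow> g i \<in> convex_cone hull S"
  shows "sum g I \<in> convex_cone hull S"
  using assms
  by (induction I rule: infinite_finite_induct)
    (simp_all add: convex_cone_hull_add convex_cone_hull_contains_0)

text \<open>Linear images of closed sets need not be closed, but this domain is a convex cone with
  finitely many generators. Its image is then a finitely generated cone, and such cones are
  closed.\<close>

lemma closed_linear_image_Times_nonneg_face:
  fixes h :: "'a::euclidean_space \<times> (real ^ 'r) \<Rightarrow> 'b::euclidean_space"
  assumes h: "linear h"
  shows "closed (h ` (UNIV \<times> {s. 0 \<le> s \<and> (\<forall>i\<in>I. s $ i = 0)}))" (is "closed (h ` ?P)")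
proof -
  interpret linear h by fact
  \<comment> \<open>The first factor is a whole space, so its basis vectors enter with both signs;
    the second contributes only the nonnegative axes that \<open>I\<close> does not force to
    zero.\<close>
  define G where "G = h ` ((\<lambda>b. (b, 0)) ` Basis \<union> (\<lambda>b. (- b, 0)) ` Basis \<union> (\<lambda>i. (0, axis i 1)) ` (- I))"
  have "h ` ?P = convex_cone hull G"
  proof
    show "h ` ?P \<subseteq> convex_cone hull G"
    proof (clarsimp)
      fix y :: 'a and s :: "real ^ 'r"
      assume s: "0 \<le> s" "\<forall>i\<in>I. s $ i = 0"
      have "h (y, s) = (\<Sum>b\<in>Basis. (y \<bullet> b) *\<^sub>R h (b, 0)) + (\<Sum>i\<in>- I. (s $ i) *\<^sub>R h (0, axis i 1))"
      proof -
        have "(\<Sum>i\<in>- I. (s $ i) *\<^sub>R axis i (1::real)) = (\<Sum>i\<in>UNIV. (s $ i) *\<^sub>R axis i 1)"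
          using s by (intro sum.mono_neutral_left) auto
        also have "\<dots> = s"
          using basis_expansion[of s] by (simp add: scalar_mult_eq_scaleR)
        finally have "(y, s) = (\<Sum>b\<in>Basis. (y \<bullet> b) *\<^sub>R (b, 0)) + (\<Sum>i\<in>- I. (s $ i) *\<^sub>R (0, axis i 1))"
          by (intro prod_eqI) (simp_all add: fst_sum snd_sum euclidean_representation)
        then show ?thesis
          by (simp add: add sum scale del: scaleR_Pair)
      qed
      \<comment> \<open>A cone admits only nonnegative multiples, so a negative coefficient is moved
        onto the generator \<open>- b\<close>.\<close>
      moreover have "(y \<bullet> b) *\<^sub>R h (b, 0) \<in> convex_cone hull G" if b: "b \<in> Basis" for b
      proof (cases "0 \<le> y \<bullet> b")
        case True
        with b show ?thesis
          by (intro convex_cone_hull_mul hull_inc) (auto simp: G_def)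
      next
        case False
        have "(y \<bullet> b) *\<^sub>R h (b, 0) = (- (y \<bullet> b)) *\<^sub>R h (- b, 0)"
          using neg[of "(b, 0)"] by simp
        also have "\<dots> \<in> convex_cone hull G"
          using b False by (intro convex_cone_hull_mul hull_inc) (auto simp: G_def)
        finally show ?thesis .
      qed
      moreover have "(s $ i) *\<^sub>R h (0, axis i 1) \<in> convex_cone hull G" if "i \<in> - I" for i
        using that s by (intro convex_cone_hull_mul hull_inc) (auto simp: G_def less_eq_vec_def)
      ultimately show "h (y, s) \<in> convex_cone hull G"
        by (auto intro!: convex_cone_hull_add convex_cone_hull_sum)
    qed
    have "convex_cone ?P"
      by (auto simp: convex_cone_iff less_eq_vec_def zero_prod_def)
    moreover have "G \<subseteq> h ` ?P"
      unfolding G_def by (intro image_mono) (auto simp: less_eq_vec_def axis_def)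
    ultimately show "convex_cone hull G \<subseteq> h ` ?P"
      using h by (intro hull_minimal) (auto intro: convex_cone_linear_image)
  qed
  moreover have "finite G"
    by (simp add: G_def)
  ultimately show ?thesis
    by (simp add: closed_convex_cone_hull)
qed

text \<open>The slack \<open>s = d - A x - B y\<close> turns the inequalities into a sign condition:
  \<open>(x, z)\<close> belongs to the set iff \<open>(d - A x, z) = (B y + s, T y)\<close> for some
  \<open>y\<close> and some \<open>s \<ge> 0\<close> vanishing on \<open>I\<close>.\<close>

lemma closed_image_face:
  fixes A :: "real ^ 'n ^ 'r" and B :: "real ^ 'm ^ 'r" and d :: "real ^ 'r"
    and T :: "real ^ 'm \<Rightarrow> 'c::euclidean_space"
  assumes T: "linear T"
  shows "closed {(x, T y) | x y. A *v x + B *v y \<le> d \<and> (\<forall>i\<in>I. (A *v x + B *v y) $ i = d $ i)}"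
    (is "closed ?S")
proof -
  interpret T: linear T by fact
  define h where "h = (\<lambda>(y, s). (B *v y + s, T y))"
  define K where "K = h ` (UNIV \<times> {s. 0 \<le> s \<and> (\<forall>i\<in>I. s $ i = 0)})"
  have "linear h"
    by (rule linearI)
      (auto simp: h_def T.add T.scale matrix_vector_right_distrib scaleR_add_right
        matrix_vector_mult_scaleR)
  then have "closed K"
    unfolding K_def by (rule closed_linear_image_Times_nonneg_face)
  moreover have "?S = (\<lambda>(x, z). (d - A *v x, z)) -` K"
  proof (intro set_eqI iffI)
    fix p assume "p \<in> ?S"
    then obtain x y where "p = (x, T y)" "A *v x + B *v y \<le> d"
      "\<forall>i\<in>I. (A *v x + B *v y) $ i = d $ i"
      by blast
    then show "p \<in> (\<lambda>(x, z). (d - A *v x, z)) -` K"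
      by (auto simp: K_def h_def less_eq_vec_def algebra_simps
          intro!: image_eqI[of _ _ "(y, d - A *v x - B *v y)"])
  next
    fix p assume "p \<in> (\<lambda>(x, z). (d - A *v x, z)) -` K"
    then obtain x y s where p: "p = (x, T y)" and d: "d = A *v x + B *v y + s"
      and s: "0 \<le> s" "\<forall>i\<in>I. s $ i = 0"
      by (cases p) (auto simp: K_def h_def algebra_simps)
    from s show "p \<in> ?S"
      by (auto simp: p d less_eq_vec_def)
  qed
  moreover have "continuous_on UNIV (\<lambda>(x, z :: 'c). (d - A *v x, z))"
    unfolding case_prod_beta
    by (intro continuous_intros linear_continuous_on_compose[OF continuous_on_fst]
        matrix_vector_mul_linear continuous_on_id)
  ultimately show ?thesis
    by (simp add: closed_vimage)
qed

definition efficient_active_set :: "real ^ 'm ^ 'r \<Rightarrow> real ^ 'm ^ 'q \<Rightarrow> 'r set \<Rightarrow> bool" where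
  "efficient_active_set B D I \<longleftrightarrow>
     (\<forall>v. (\<forall>i\<in>I. (B *v v) $ i \<le> 0) \<longrightarrow> D *v v \<le> 0 \<longrightarrow> D *v v = 0)"

text \<open>Here \<open>I\<close> may be any subset of the active set. Requiring equality with the
  active set would describe relatively open pieces; by monotonicity, closed faces suffice.\<close>

lemma efficiency_mapping_polyhedral_iff:
  fixes A :: "real ^ 'n ^ 'r" and B :: "real ^ 'm ^ 'r" and D :: "real ^ 'm ^ 'q"
    and d :: "real ^ 'r"
  shows "y \<in> efficiency_mapping (\<lambda>x y. D *v y) (\<lambda>x. {y. A *v x + B *v y \<le> d}) {z. 0 \<le> z} x \<longleftrightarrow>
     (\<exists>I. efficient_active_set B D I \<and> A *v x + B *v y \<le> d \<and>
       (\<forall>i\<in>I. (A *v x + B *v y) $ i = d $ i))" (is "_ \<longleftrightarrow> (\<exists>I. ?R I)")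
proof -
  have eff: "y \<in> efficiency_mapping (\<lambda>x y. D *v y) (\<lambda>x. {y. A *v x + B *v y \<le> d}) {z. 0 \<le> z} x \<longleftrightarrow>
      A *v x + B *v y \<le> d \<and>
      (\<forall>w. A *v x + B *v w \<le> d \<longrightarrow> D *v w \<le> D *v y \<longrightarrow> D *v w = D *v y)" (is "?E \<longleftrightarrow> ?E'")
  proof -
    \<comment> \<open>The forbidden values are exactly those dominating \<open>D y\<close>:
      \<open>u\<close> arises from \<open>c = D y - u\<close>.\<close>
    have "(\<lambda>c. D *v y - c) ` ({z. 0 \<le> z} - {0}) = {u. u \<le> D *v y \<and> u \<noteq> D *v y}"
    proof (intro set_eqI iffI)
      fix u assume "u \<in> {u. u \<le> D *v y \<and> u \<noteq> D *v y}"
      then show "u \<in> (\<lambda>c. D *v y - c) ` ({z. 0 \<le> z} - {0})"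
        by (intro image_eqI[of _ _ "D *v y - u"]) (auto simp: less_eq_vec_def)
    qed (auto simp: less_eq_vec_def)
    then show ?thesis
      by (auto simp: efficiency_mapping_def)
  qed
  show ?thesis
    unfolding eff
  proof
    assume opt: ?E'
    define I where "I = {i. (A *v x + B *v y) $ i = d $ i}"
    have "efficient_active_set B D I"
      unfolding efficient_active_set_def
    proof (intro allI impI)
      fix v assume v: "\<forall>i\<in>I. (B *v v) $ i \<le> 0" "D *v v \<le> 0"
      \<comment> \<open>A short step along \<open>v\<close> keeps each row feasible: an active row
        does not increase, and an inactive one has strict slack at \<open>t = 0\<close>, which
        survives by continuity.\<close>
      have "\<forall>\<^sub>F t in at_right 0. (A *v x + B *v y) $ i + t * (B *v v) $ i \<le> d $ i" for i
      proof (cases "i \<in> I")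
        case True
        with v have "(A *v x + B *v y) $ i + t * (B *v v) $ i \<le> d $ i" if "t > 0" for t
          using that by (auto simp: I_def mult_nonneg_nonpos)
        then show ?thesis
          by (auto simp: eventually_at_filter)
      next
        case False
        with opt have "(A *v x + B *v y) $ i < d $ i"
          by (auto simp: I_def less_eq_vec_def less_le)
        moreover have "((\<lambda>t. (A *v x + B *v y) $ i + t * (B *v v) $ i) \<longlongrightarrow>
            (A *v x + B *v y) $ i + 0 * (B *v v) $ i) (at_right 0)"
          by (intro tendsto_intros)
        ultimately have "\<forall>\<^sub>F t in at_right 0. (A *v x + B *v y) $ i + t * (B *v v) $ i < d $ i"
          by (auto dest: order_tendstoD)
        then show ?thesis
          by eventually_elim simp
      qed
      \<comment> \<open>There are finitely many rows, so one positive step length serves them all;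
        efficiency of \<open>y\<close> is then tested against \<open>y + t v\<close>.\<close>
      then have "\<forall>\<^sub>F t in at_right (0::real). 0 < t \<and>
          (\<forall>i. (A *v x + B *v y) $ i + t * (B *v v) $ i \<le> d $ i)"
        by (intro eventually_conj eventually_all_finite eventually_at_right_less)
      then obtain t :: real where t: "0 < t"
        and feas: "(A *v x + B *v y) $ i + t * (B *v v) $ i \<le> d $ i" for i
        by (auto dest!: eventually_happens)
      have "A *v x + B *v (y + t *\<^sub>R v) \<le> d"
        using feas by (simp add: less_eq_vec_def matrix_vector_right_distrib matrix_vector_mult_scaleR add.assoc)
      moreover have "D *v (y + t *\<^sub>R v) \<le> D *v y"
        using v t by (simp add: less_eq_vec_def matrix_vector_right_distrib matrix_vector_mult_scaleR mult_nonneg_nonpos)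
      ultimately have "D *v (y + t *\<^sub>R v) = D *v y"
        using opt by blast
      then show "D *v v = 0"
        using t by (simp add: matrix_vector_right_distrib matrix_vector_mult_scaleR)
    qed
    with opt have "?R I"
      by (simp add: I_def)
    then show "\<exists>I. ?R I" ..
  next
    assume "\<exists>I. ?R I"
    then obtain I where I: "?R I" ..
    \<comment> \<open>The direction to test is \<open>w - y\<close>: rows in \<open>I\<close> are
      tight at \<open>y\<close> and satisfied at \<open>w\<close>, so they cannot increase along
      it.\<close>
    have "D *v w = D *v y" if w: "A *v x + B *v w \<le> d" "D *v w \<le> D *v y" for w
    proof -
      have "\<forall>i\<in>I. (B *v (w - y)) $ i \<le> 0"
      proof
        fix i assume "i \<in> I"
        with I have "(A *v x + B *v y) $ i = d $ i" by blast
        moreover have "(A *v x + B *v w) $ i \<le> d $ i"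
          using w by (simp add: less_eq_vec_def)
        ultimately show "(B *v (w - y)) $ i \<le> 0"
          by (simp add: matrix_vector_mult_diff_distrib)
      qed
      moreover have "D *v (w - y) \<le> 0"
        using w by (simp add: matrix_vector_mult_diff_distrib less_eq_vec_def)
      ultimately have "D *v (w - y) = 0"
        using I by (simp add: efficient_active_set_def)
      then show ?thesis
        by (simp add: matrix_vector_mult_diff_distrib)
    qed
    with I show ?E'
      by blast
  qed
qed

theorem lemma3p11:
  fixes A :: "real ^ 'n ^ 'r" and B :: "real ^ 'm ^ 'r" and D :: "real ^ 'm ^ 'q"
    and d :: "real ^ 'r"
    and f :: "real ^ 'n \<Rightarrow> real ^ 'm \<Rightarrow> real ^ 'q"
    and \<Gamma> :: "real ^ 'n \<Rightarrow> (real ^ 'm) set"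
    and C :: "(real ^ 'q) set"
  assumes "\<And>x y. f x y = D *v y"
    and "\<And>x. \<Gamma> x = {y. A *v x + B *v y \<le> d}"
    and "C = {z. 0 \<le> z}"
  shows "closed (gph (efficiency_mapping f \<Gamma> C)) \<and> closed (gph (frontier_mapping f \<Gamma> C))"
proof -
  define face where "face I = {(x, y). A *v x + B *v y \<le> d \<and>
    (\<forall>i\<in>I. (A *v x + B *v y) $ i = d $ i)}" for I
  define F where "F = {I. efficient_active_set B D I}"
  \<comment> \<open>One statement serves both graphs: \<open>T = id\<close> yields the efficiency
    mapping and \<open>T = D\<close> the frontier mapping. The union is finite because there are
    finitely many sets of row indices.\<close>
  have closed_image: "closed (\<Union>I\<in>F. (\<lambda>(x, y). (x, T y)) ` face I)" if "linear T"
    for T :: "real ^ 'm \<Rightarrow> 'c::euclidean_space"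
  proof (intro closed_UN ballI)
    fix I
    have "(\<lambda>(x, y). (x, T y)) ` face I =
        {(x, T y) | x y. A *v x + B *v y \<le> d \<and> (\<forall>i\<in>I. (A *v x + B *v y) $ i = d $ i)}"
      by (force simp: face_def)
    then show "closed ((\<lambda>(x, y). (x, T y)) ` face I)"
      using closed_image_face[OF that] by simp
  qed simp
  have f\<Gamma>: "f = (\<lambda>x y. D *v y)" "\<Gamma> = (\<lambda>x. {y. A *v x + B *v y \<le> d})"
    using assms by auto
  have eff: "y \<in> efficiency_mapping f \<Gamma> C x \<longleftrightarrow> (\<exists>I\<in>F. (x, y) \<in> face I)" for x y
    by (auto simp: f\<Gamma> assms(3) F_def face_def efficiency_mapping_polyhedral_iff)
  have "gph (efficiency_mapping f \<Gamma> C) = (\<Union>I\<in>F. (\<lambda>(x, y). (x, id y)) ` face I)"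
    by (auto simp: gph_def eff)
  moreover have "gph (frontier_mapping f \<Gamma> C) = (\<Union>I\<in>F. (\<lambda>(x, y). (x, D *v y)) ` face I)"
    by (force simp: gph_def frontier_mapping_def eff assms(1) image_iff)
  ultimately show ?thesis
    using closed_image[OF linear_id] closed_image[OF matrix_vector_mul_linear[of D]]
    by (simp only:)
qed

end
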